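(* Let $P=(\varphi_n)_{n=0}^\infty$ be a fixed sequence of functions as in the context. Let $x_0=\sup\Delta^{P^-}_{c_1\ldots c_k}$ for some $P^-$-cylinder $\Delta^{P^-}_{c_1\ldots c_k}$ of rank $k$, where $k$ is odd, and let $(x_n)_{n=1}^\infty$ be a sequence of numbers from $(0,1)\setminus IS^{P^-}$ such that $0<x_n<x_0$ for all $n\in\mathbb{N}$. Then $\lim_{n\to\infty}x_n=x_0$ if and only if there exists a number $n_0$ such that $$\begin{cases} q_i(x_n)=c_i \text{ for all } i\leq k \text{ and all } n\geq n_0,\\ \lim_{n\to\infty}q_{k+1}(x_n)=\infty.\end{cases}$$
   Context: $\mathbb{N}=\{1,2,3,\ldots\}$. Fix a sequence $P=(\varphi_n)_{n=0}^\infty$, where $\varphi_0\in\mathbb{N}$ is a constant and, for $n\ge 1$, $\varphi_n\colon\mathbb{N}^n\to\mathbb{N}$ is an arbitrary function. The $P^-$-representation (alternating Perron expansion) of $x\in(0,1]$ is an expansion $$x=\sum_{n=0}^{\infty}\frac{(-1)^n r_0 r_1\cdots r_n}{(q_1-1)q_1\cdots(q_n-1)q_n\,(q_{n+1}-1)},$$ where $q_1,q_2,\ldots\in\mathbb{N}$, $r_0=\varphi_0$, $r_n=\varphi_n(q_1,\ldots,q_n)$ and $q_n\ge r_{n-1}+1$ for all $n\in\mathbb{N}$ (the $n=0$ term is $r_0/(q_1-1)$). $IS^{P^-}\subset(0,1]$ denotes the set of numbers in $(0,1]$ that have no $P^-$-representation; it is known to be countably infinite. It is known that every $x\in(0,1)\setminus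 IS^{P^-}$ has a unique $P^-$-representation; the number $q_n=q_n(x)$ is called the $n$th $P^-$-digit of $x$. For $k\ge 1$, the $P^-$-cylinder of rank $k$ with base $c_1\ldots c_k$ is the set $\Delta^{P^-}_{c_1\ldots c_k}$ of all $x\in(0,1)\setminus IS^{P^-}$ with $q_1(x)=c_1,\ldots,q_k(x)=c_k$; here the base is admissible, i.e. $c_1\ge\varphi_0+1$ and $c_i\ge\varphi_{i-1}(c_1,\ldots,c_{i-1})+1$ for $2\le i\le k$, so that the cylinder is nonempty. It is known that each $P^-$-cylinder has the form $(a,b)\setminus IS^{P^-}$, and that $IS^{P^-}$ is exactly the set of infima and suprema of all $P^-$-cylinders. *)

theory Defs
  imports Complex_Main
begin

text \<open>
  The sequence \<open>P = (\<phi>\<^sub>n)\<close> is a function \<open>P :: nat \<Rightarrow> nat list \<Rightarrow> nat\<close>, where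
  \<open>\<phi>\<^sub>n (q\<^sub>1, \<dots>, q\<^sub>n)\<close> is \<open>P n [q\<^sub>1, \<dots>, q\<^sub>n]\<close> and the constant \<open>\<phi>\<^sub>0\<close> is \<open>P 0 []\<close>; only the values
  of \<open>P n\<close> on lists of length \<open>n\<close> with positive entries matter.
  Digit sequences are functions \<open>q :: nat \<Rightarrow> nat\<close> indexed from 1; the value \<open>q 0\<close> is never used.
\<close>

definition perron_seq :: "(nat \<Rightarrow> nat list \<Rightarrow> nat) \<Rightarrow> bool" where
  "perron_seq P \<longleftrightarrow> (\<forall>n qs. length qs = n \<and> (\<forall>q\<in>set qs. 1 \<le> q) \<longrightarrow> 1 \<le> P n qs)"

definition perron_r :: "(nat \<Rightarrow> nat list \<Rightarrow> nat) \<Rightarrow> (nat \<Rightarrow> nat) \<Rightarrow> nat \<Rightarrow> nat" where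
  "perron_r P q n = P n (map q [1..<n + 1])"

definition perron_term :: "(nat \<Rightarrow> nat list \<Rightarrow> nat) \<Rightarrow> (nat \<Rightarrow> nat) \<Rightarrow> nat \<Rightarrow> real" where
  "perron_term P q n =
     (-1) ^ n * (\<Prod>i=0..n. real (perron_r P q i)) /
     ((\<Prod>i=1..n. (real (q i) - 1) * real (q i)) * (real (q (n + 1)) - 1))"

definition perron_rep :: "(nat \<Rightarrow> nat list \<Rightarrow> nat) \<Rightarrow> (nat \<Rightarrow> nat) \<Rightarrow> real \<Rightarrow> bool" where
  "perron_rep P q x \<longleftrightarrow>
     (\<forall>n\<ge>1. q n \<ge> perron_r P q (n - 1) + 1) \<and> perron_term P q sums x"

definition perron_IS :: "(nat \<Rightarrow> nat list \<Rightarrow> nat) \<Rightarrow> real set" where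
  "perron_IS P = {x \<in> {0<..1}. \<not> (\<exists>q. perron_rep P q x)}"

text \<open>Meaningful for \<open>n \<ge> 1\<close> and \<open>x \<in> {0<..<1} - perron_IS P\<close>, where the representation is unique.\<close>

definition perron_digit :: "(nat \<Rightarrow> nat list \<Rightarrow> nat) \<Rightarrow> nat \<Rightarrow> real \<Rightarrow> nat" where
  "perron_digit P n x = (THE d. \<exists>q. perron_rep P q x \<and> q n = d)"

text \<open>A base \<open>c\<^sub>1\<dots>c\<^sub>k\<close> is given by \<open>k\<close> and a function \<open>c\<close>, of which only \<open>c 1, \<dots>, c k\<close> are used.\<close>

definition admissible_base :: "(nat \<Rightarrow> nat list \<Rightarrow> nat) \<Rightarrow> nat \<Rightarrow> (nat \<Rightarrow> nat) \<Rightarrow> bool" where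
  "admissible_base P k c \<longleftrightarrow> (\<forall>i\<in>{1..k}. c i \<ge> perron_r P c (i - 1) + 1)"

definition perron_cylinder :: "(nat \<Rightarrow> nat list \<Rightarrow> nat) \<Rightarrow> nat \<Rightarrow> (nat \<Rightarrow> nat) \<Rightarrow> real set" where
  "perron_cylinder P k c =
     {x \<in> {0<..<1} - perron_IS P. \<forall>i\<in>{1..k}. perron_digit P i x = c i}"

end

theory Submission
  imports Defs
begin

text \<open>
  Fix the first \<open>k\<close> digits of an expansion and call \<open>y\<close> what is left after its first \<open>k\<close> terms,
  rescaled: \<open>x = S\<^sub>k + (-1)\<^sup>k A\<^sub>k y\<close>, where the partial sum \<open>S\<^sub>k\<close> and the weight \<open>A\<^sub>k > 0\<close> depend on those
  digits only. One more digit \<open>d = q\<^sub>k\<^sub>+\<^sub>1\<close> replaces \<open>y\<close> by \<open>r\<^sub>k / (d - 1) \<sqdot> (1 - y / d)\<close>, and this map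
  sends \<open>(0,1)\<close> into the interval \<open>(r\<^sub>k / d, r\<^sub>k / (d - 1))\<close>. For different \<open>d\<close> these intervals are
  disjoint, so the remainder \<open>y\<close> determines the next digit, and all of them lie in \<open>(0,1)\<close>, so the
  images of \<open>(0,1)\<close> under the maps \<open>y \<mapsto> S\<^sub>k + (-1)\<^sup>k A\<^sub>k y\<close> are nested
  (lemmas \<open>branch_Suc\<close>, \<open>next_rem_bounds\<close>, \<open>perron_rep_remainder\<close>).

  It follows that a representable number has the digits \<open>c\<^sub>1 \<dots> c\<^sub>k\<close> exactly if its remainder with
  respect to \<open>c\<close> lies in \<open>(0,1)\<close> (\<open>digits_eq_if_branch\<close>), and that the remainder tends to \<open>0\<close> exactly
  if the next digit tends to infinity. For odd \<open>k\<close> the map \<open>y \<mapsto> S\<^sub>k - A\<^sub>k y\<close> is decreasing and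
  arbitrarily large next digits occur, so the supremum of the cylinder is its value at \<open>y = 0\<close>
  (\<open>Sup_perron_cylinder_odd\<close>). Hence \<open>x\<^sub>n\<close> tends to the supremum from below exactly if the
  remainders of \<open>x\<^sub>n\<close> with respect to \<open>c\<close> tend to \<open>0\<close> from above, that is, if the first \<open>k\<close> digits
  eventually agree with \<open>c\<close> and the next one tends to infinity.
\<close>

section \<open>Admissible digits\<close>

lemma perron_r_cong:
  assumes "\<And>i. i \<in> {1..k} \<Longrightarrow> q i = q' i"
  shows "perron_r P q k = perron_r P q' k"
proof -
  have "map q [1..<k + 1] = map q' [1..<k + 1]" using assms by auto
  then show ?thesis by (simp only: perron_r_def)
qed

lemma admissible_base_mono: "admissible_base P k q \<Longrightarrow> j \<le> k \<Longrightarrow> admissible_base P j q"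
  by (auto simp: admissible_base_def)

lemma admissible_base_Suc:
  "admissible_base P (Suc k) q \<longleftrightarrow> admissible_base P k q \<and> perron_r P q k + 1 \<le> q (Suc k)"
  by (auto simp: admissible_base_def atLeastAtMostSuc_conv)

lemma admissible_base_cong:
  assumes "\<And>i. i \<in> {1..k} \<Longrightarrow> q i = q' i"
  shows "admissible_base P k q \<longleftrightarrow> admissible_base P k q'"
proof -
  have "perron_r P q (i - 1) = perron_r P q' (i - 1)" if "i \<in> {1..k}" for i
    using that assms by (intro perron_r_cong) auto
  then show ?thesis using assms by (simp add: admissible_base_def)
qed

lemma perron_rep_iff:
  "perron_rep P q x \<longleftrightarrow> (\<forall>k. admissible_base P k q) \<and> perron_term P q sums x"
proof -
  have "(\<forall>n\<ge>1. q n \<ge> perron_r P q (n - 1) + 1) \<longleftrightarrow> (\<forall>k. admissible_base P k q)"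
    unfolding admissible_base_def by (metis atLeastAtMost_iff order_refl)
  then show ?thesis by (simp add: perron_rep_def)
qed

lemma perron_r_pos:
  assumes "perron_seq P" "admissible_base P k q"
  shows "1 \<le> perron_r P q k"
proof -
  have "\<forall>d\<in>set (map q [1..<k + 1]). 1 \<le> d"
    using assms(2) by (force simp: admissible_base_def)
  moreover have "length (map q [1..<k + 1]) = k" by simp
  ultimately show ?thesis using assms(1) unfolding perron_seq_def perron_r_def by blast
qed

fun minimal_extension :: "(nat \<Rightarrow> nat list \<Rightarrow> nat) \<Rightarrow> nat \<Rightarrow> (nat \<Rightarrow> nat) \<Rightarrow> nat \<Rightarrow> nat" where
  "minimal_extension P k c n =
     (if n \<le> k then c n else P (n - 1) (map (minimal_extension P k c) [1..<n]) + 1)"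

declare minimal_extension.simps [simp del]

lemma admissible_extension_exists:
  assumes "admissible_base P k c"
  obtains q where "\<And>i. i \<in> {1..k} \<Longrightarrow> q i = c i" "\<And>j. admissible_base P j q"
proof -
  define q where "q = minimal_extension P k c"
  have q_c: "q i = c i" if "i \<in> {1..k}" for i
    using that by (simp add: q_def minimal_extension.simps[of P k c i])
  have q_Suc: "q (Suc j) = perron_r P q j + 1" if "j \<ge> k" for j
    using that unfolding q_def perron_r_def by (subst minimal_extension.simps) simp
  have base: "admissible_base P k q"
    using assms admissible_base_cong[of k q c P] q_c by simp
  have "admissible_base P j q" for j
  proof (induction j)
    case (Suc j)
    then show ?case
      using admissible_base_mono[OF base, of "Suc j"] q_Suc[of j]
      by (cases "k \<le> j") (simp_all add: admissible_base_Suc)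
  qed (simp add: admissible_base_def)
  with q_c that show ?thesis by blast
qed

section \<open>Remainders and inverse branches\<close>

definition perron_weight :: "(nat \<Rightarrow> nat list \<Rightarrow> nat) \<Rightarrow> (nat \<Rightarrow> nat) \<Rightarrow> nat \<Rightarrow> real" where
  "perron_weight P q k =
     (\<Prod>i<k. real (perron_r P q i) / ((real (q (Suc i)) - 1) * real (q (Suc i))))"

text \<open>
  The number whose expansion starts with the digits \<open>q 1, \<dots>, q k\<close> and leaves the remainder \<open>y\<close>:
  the \<open>k\<close>-th inverse branch of the digit expansion, in the sense of dynamical systems.
\<close>

definition branch :: "(nat \<Rightarrow> nat list \<Rightarrow> nat) \<Rightarrow> (nat \<Rightarrow> nat) \<Rightarrow> nat \<Rightarrow> real \<Rightarrow> real" where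
  "branch P q k y = (\<Sum>n<k. perron_term P q n) + (-1) ^ k * perron_weight P q k * y"

text \<open>
  The remainder before a digit \<open>d\<close>, in terms of the remainder \<open>y\<close> after it, when \<open>r\<close> is the
  numerator of that step.
\<close>

definition next_rem :: "real \<Rightarrow> nat \<Rightarrow> real \<Rightarrow> real" where
  "next_rem r d y = r / (real d - 1) * (1 - y / real d)"

lemma perron_term_eq_weight:
  "perron_term P q n =
     (-1) ^ n * perron_weight P q n * (real (perron_r P q n) / (real (q (Suc n)) - 1))"
proof -
  have "(\<Prod>i=0..n. real (perron_r P q i)) = (\<Prod>i<n. real (perron_r P q i)) * real (perron_r P q n)"
    by (simp add: atLeast0AtMost lessThan_Suc_atMost[symmetric])
  moreover have "(\<Prod>i=1..n. (real (q i) - 1) * real (q i)) =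
      (\<Prod>i<n. (real (q (Suc i)) - 1) * real (q (Suc i)))"
    by (rule prod.reindex_bij_witness[of _ Suc "\<lambda>i. i - 1"]) auto
  ultimately show ?thesis
    by (simp add: perron_term_def perron_weight_def prod_dividef)
qed

lemma branch_Suc:
  assumes "2 \<le> q (Suc k)"
  shows "branch P q (Suc k) y = branch P q k (next_rem (perron_r P q k) (q (Suc k)) y)"
proof -
  have split: "w * (r / (d - 1)) - w * (r / ((d - 1) * d)) * y = w * (r / (d - 1) * (1 - y / d))"
    if "d \<ge> 2" for w r d :: real
    using that by (simp add: right_diff_distrib)
  have "perron_weight P q (Suc k) = perron_weight P q k *
      (real (perron_r P q k) / ((real (q (Suc k)) - 1) * real (q (Suc k))))"
    by (simp add: perron_weight_def)
  then show ?thesis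
    using split[of "real (q (Suc k))" "(-1) ^ k * perron_weight P q k" "real (perron_r P q k)"] assms
    by (simp add: branch_def next_rem_def perron_term_eq_weight)
qed

lemma branch_0 [simp]: "branch P q 0 y = y"
  by (simp add: branch_def perron_weight_def)

lemma branch_cong:
  assumes "\<And>i. i \<in> {1..k} \<Longrightarrow> q i = q' i"
  shows "branch P q k y = branch P q' k y"
proof -
  have r: "perron_r P q i = perron_r P q' i" if "i < k" for i
    using that assms by (intro perron_r_cong) auto
  have w: "perron_weight P q j = perron_weight P q' j" if "j \<le> k" for j
    unfolding perron_weight_def using that assms r by (intro prod.cong) auto
  have "perron_term P q n = perron_term P q' n" if "n < k" for n
    using that r[of n] w[of n] assms by (simp add: perron_term_eq_weight)
  then show ?thesis using w[of k] by (simp add: branch_def)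
qed

lemma next_rem_bounds:
  assumes "1 \<le> r" "r + 1 \<le> d"
  shows "y \<in> {0..1} \<Longrightarrow> next_rem (real r) d y \<in> {0<..1}"
    and "y \<in> {0<..1} \<Longrightarrow> next_rem (real r) d y \<in> {0<..<1}"
    and "y \<in> {0<..<1} \<Longrightarrow> next_rem (real r) d y \<in> {real r / real d<..<real r / (real d - 1)}"
proof -
  define s where "s = real r / (real d - 1)"
  have d: "real d \<ge> 2" "0 < s" "s \<le> 1"
    using assms by (auto simp: s_def divide_simps)
  have eq: "next_rem (real r) d y = s * (1 - y / real d)" by (simp add: next_rem_def s_def)
  have low: "real r / real d = s * (1 - 1 / real d)"
    using d by (simp add: s_def divide_simps)
  { assume y: "y \<in> {0..1}"
    have "y / real d < 1" "0 \<le> y / real d" using y d by (auto simp: divide_simps)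
    then have "0 < next_rem (real r) d y" "next_rem (real r) d y \<le> s * 1"
      unfolding eq using d by (auto intro!: mult_left_mono)
    then show "next_rem (real r) d y \<in> {0<..1}" using d by auto
  } note 1 = this
  have upper: "next_rem (real r) d y < s" if "0 < y"
    unfolding eq using that d by (simp add: mult_less_cancel_left2)
  { assume y: "y \<in> {0<..1}"
    show "next_rem (real r) d y \<in> {0<..<1}" using 1 upper y d by auto }
  { assume y: "y \<in> {0<..<1}"
    have "real r / real d < next_rem (real r) d y"
      unfolding eq low using y d
      by (intro mult_strict_left_mono diff_strict_left_mono divide_strict_right_mono) auto
    then show "next_rem (real r) d y \<in> {real r / real d<..<real r / (real d - 1)}"
      using upper y unfolding s_def by auto }
qed

text \<open>
  The intervals \<open>(r / d, r / (d - 1))\<close> are disjoint: \<open>d - 1 < r / y < d\<close>.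
\<close>

lemma digit_of_remainder_unique:
  fixes d d' r :: nat and y :: real
  assumes "1 \<le> r" "2 \<le> d" "2 \<le> d'"
    and "y \<in> {real r / real d<..<real r / (real d - 1)}"
    and "y \<in> {real r / real d'<..<real r / (real d' - 1)}"
  shows "d = d'"
proof -
  have "0 < real r / real d" using assms(1,2) by simp
  then have y: "0 < y" using assms(4) by (auto intro: less_trans)
  have "real e - 1 < real r / y \<and> real r / y < real e"
    if "2 \<le> e" "y \<in> {real r / real e<..<real r / (real e - 1)}" for e :: nat
    using that y by (simp add: field_simps)
  from this[OF assms(2,4)] this[OF assms(3,5)] show ?thesis by linarith
qed

section \<open>Existence and uniqueness of expansions\<close>

context
  fixes P :: "nat \<Rightarrow> nat list \<Rightarrow> nat"
  assumes P: "perron_seq P"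
begin

lemma admissible_Suc_bounds:
  assumes "admissible_base P (Suc k) q"
  shows "1 \<le> perron_r P q k" "perron_r P q k + 1 \<le> q (Suc k)" "2 \<le> q (Suc k)"
  using assms perron_r_pos[OF P, of k q] by (auto simp: admissible_base_Suc)

lemma perron_weight_bounds:
  assumes "admissible_base P k q"
  shows "0 < perron_weight P q k \<and> perron_weight P q k \<le> (1 / 2) ^ k"
  using assms
proof (induction k)
  case 0
  then show ?case by (simp add: perron_weight_def)
next
  case (Suc k)
  note b = admissible_Suc_bounds[OF Suc.prems]
  let ?s = "real (perron_r P q k) / ((real (q (Suc k)) - 1) * real (q (Suc k)))"
  have "real (perron_r P q k) / (real (q (Suc k)) - 1) \<le> 1" using b by (simp add: divide_simps)
  then have "real (perron_r P q k) / (real (q (Suc k)) - 1) / real (q (Suc k)) \<le> 1 / 2"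
    using b by (intro frac_le) auto
  then have "?s \<le> 1 / 2" by simp
  moreover have "0 < ?s" using b by simp
  moreover have IH: "0 < perron_weight P q k" "perron_weight P q k \<le> (1 / 2) ^ k"
    using Suc by (auto simp: admissible_base_Suc)
  ultimately have "perron_weight P q k * ?s \<le> (1 / 2) ^ k * (1 / 2)"
    by (intro mult_mono) auto
  moreover have "perron_weight P q (Suc k) = perron_weight P q k * ?s"
    by (simp add: perron_weight_def)
  ultimately show ?case using mult_pos_pos[OF IH(1) \<open>0 < ?s\<close>] by simp
qed

lemma branch_inject:
  assumes "admissible_base P k q" "branch P q k y = branch P q k z"
  shows "y = z"
  using perron_weight_bounds[OF assms(1)] assms(2) by (simp add: branch_def)

lemma branch_image_nested:
  assumes "admissible_base P (k + m) q" "y \<in> {0..1}"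
  shows "\<exists>z\<in>{0..1}. branch P q (k + m) y = branch P q k z"
  using assms
proof (induction m arbitrary: y)
  case (Suc m)
  have adm: "admissible_base P (Suc (k + m)) q" using Suc.prems by simp
  note b = admissible_Suc_bounds[OF adm]
  have "next_rem (perron_r P q (k + m)) (q (Suc (k + m))) y \<in> {0..1}"
    using next_rem_bounds(1)[OF b(1,2) Suc.prems(2)] by auto
  with Suc.IH adm show ?case by (simp add: branch_Suc[of q _ P, OF b(3)] admissible_base_Suc)
qed auto

text \<open>
  The partial sums from index \<open>k\<close> on lie in the closed image of \<open>[0,1]\<close> under the \<open>k\<close>-th branch,
  hence so does the sum. That the remainder is not an end point of its interval follows by looking
  three digits ahead: each step back improves the bounds.
\<close>

lemma perron_rep_remainder:
  assumes rep: "perron_rep P q x"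
  obtains y where "x = branch P q k y"
    "y \<in> {real (perron_r P q k) / real (q (Suc k))<..<real (perron_r P q k) / (real (q (Suc k)) - 1)}"
proof -
  have sums: "perron_term P q sums x" and adm: "admissible_base P j q" for j
    using rep by (auto simp: perron_rep_iff)
  have closed_image: "\<exists>y\<in>{0..1}. x = branch P q j y" for j
  proof -
    have "continuous_on {0..1} (branch P q j)"
      unfolding branch_def by (intro continuous_intros)
    then have "closed (branch P q j ` {0..1})"
      by (intro compact_imp_closed compact_continuous_image compact_Icc)
    moreover have "branch P q (j + n) 0 \<in> branch P q j ` {0..1}" for n
    proof -
      obtain z where "z \<in> {0..1}" "branch P q (j + n) 0 = branch P q j z"
        using branch_image_nested[OF adm, of 0 j n] by auto
      then show ?thesis by simp
    qed
    moreover have "(\<lambda>n. branch P q (j + n) 0) \<longlonglongrightarrow> x"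
    proof -
      have "(\<lambda>n. \<Sum>i<n + j. perron_term P q i) \<longlonglongrightarrow> x"
        using LIMSEQ_ignore_initial_segment sums unfolding sums_def .
      then show ?thesis unfolding branch_def by (simp add: add.commute)
    qed
    ultimately have "x \<in> branch P q j ` {0..1}" by (rule closed_sequentially)
    then show ?thesis by auto
  qed
  let ?g = "\<lambda>j. next_rem (perron_r P q j) (q (Suc j))"
  obtain y where y: "y \<in> {0..1}" "x = branch P q (Suc (Suc (Suc k))) y"
    using closed_image by blast
  note b = admissible_Suc_bounds[OF adm]
  have "?g (Suc (Suc k)) y \<in> {0<..1}" by (rule next_rem_bounds(1)[OF b(1,2) y(1)])
  then have "?g (Suc k) (?g (Suc (Suc k)) y) \<in> {0<..<1}" by (rule next_rem_bounds(2)[OF b(1,2)])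
  note bounds = next_rem_bounds(3)[OF b(1,2)[of k] this]
  have "x = branch P q k (?g k (?g (Suc k) (?g (Suc (Suc k)) y)))"
    unfolding y(2) by (simp only: branch_Suc b(3))
  then show ?thesis using bounds by (rule that)
qed

lemma remainder_in_unit_interval:
  assumes "admissible_base P (Suc k) q"
    and "y \<in> {real (perron_r P q k) / real (q (Suc k))<..<real (perron_r P q k) / (real (q (Suc k)) - 1)}"
  shows "y \<in> {0<..<1}"
proof -
  note b = admissible_Suc_bounds[OF assms(1)]
  have "0 < real (perron_r P q k) / real (q (Suc k))" using b by simp
  moreover have "real (perron_r P q k) / (real (q (Suc k)) - 1) \<le> 1" using b by (simp add: divide_simps)
  ultimately show ?thesis using assms(2) by auto
qed

lemma perron_rep_sum_in_unit_interval:
  assumes "perron_rep P q x"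
  shows "x \<in> {0<..<1}"
proof -
  have "admissible_base P (Suc 0) q" using assms by (simp add: perron_rep_iff)
  moreover obtain y where "x = branch P q 0 y"
    "y \<in> {real (perron_r P q 0) / real (q (Suc 0))<..<real (perron_r P q 0) / (real (q (Suc 0)) - 1)}"
    using perron_rep_remainder[OF assms] .
  ultimately show ?thesis using remainder_in_unit_interval[of 0 q y] by simp
qed

text \<open>
  The digits are recovered one after the other: once the first \<open>j\<close> agree with \<open>c\<close>, injectivity of
  the branch identifies the remainder, and the remainder determines the next digit.
\<close>

lemma digits_eq_if_branch:
  assumes rep: "perron_rep P q x" and adm: "admissible_base P k c"
    and "y \<in> {0<..<1}" "x = branch P c k y" and "i \<in> {1..k}"
  shows "q i = c i"
  using assms(2-)
proof (induction k arbitrary: y i)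
  case (Suc k)
  note b = admissible_Suc_bounds[OF Suc.prems(1)]
  let ?z = "next_rem (perron_r P c k) (c (Suc k)) y"
  have z: "?z \<in> {real (perron_r P c k) / real (c (Suc k))<..<real (perron_r P c k) / (real (c (Suc k)) - 1)}"
    by (rule next_rem_bounds(3)[OF b(1,2) Suc.prems(2)])
  have xz: "x = branch P c k ?z" using Suc.prems(3) b(3) by (simp add: branch_Suc)
  have admk: "admissible_base P k c" using Suc.prems(1) by (simp add: admissible_base_Suc)
  have eq: "q i = c i" if "i \<in> {1..k}" for i
    using Suc.IH[OF admk remainder_in_unit_interval[OF Suc.prems(1) z] xz that] .
  obtain w where w: "x = branch P q k w"
    "w \<in> {real (perron_r P q k) / real (q (Suc k))<..<real (perron_r P q k) / (real (q (Suc k)) - 1)}"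
    using perron_rep_remainder[OF rep] .
  have r: "perron_r P q k = perron_r P c k" using eq by (rule perron_r_cong)
  have "w = ?z"
    using branch_inject[OF admk] w(1) xz branch_cong[of k q c P w] eq by simp
  moreover have "2 \<le> q (Suc k)"
    using rep by (intro admissible_Suc_bounds(3)) (simp add: perron_rep_iff)
  ultimately have "q (Suc k) = c (Suc k)"
    using digit_of_remainder_unique[OF b(1) _ b(3)] w(2) z r by metis
  with eq Suc.prems(4) show ?case by (cases "i = Suc k") auto
qed simp

lemma perron_rep_unique:
  assumes "perron_rep P q x" "perron_rep P q' x" "1 \<le> n"
  shows "q n = q' n"
proof -
  have adm: "admissible_base P j q'" for j using assms(2) by (simp add: perron_rep_iff)
  obtain y where y: "x = branch P q' n y"
    "y \<in> {real (perron_r P q' n) / real (q' (Suc n))<..<real (perron_r P q' n) / (real (q' (Suc n)) - 1)}"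
    using perron_rep_remainder[OF assms(2)] .
  show ?thesis
    using digits_eq_if_branch[OF assms(1) adm remainder_in_unit_interval[OF adm y(2)] y(1)] assms(3)
    by simp
qed

lemma perron_digit_eq:
  assumes "perron_rep P q x" "1 \<le> n"
  shows "perron_digit P n x = q n"
  unfolding perron_digit_def
proof (rule the_equality)
  show "\<exists>q'. perron_rep P q' x \<and> q' n = q n" using assms(1) by blast
  show "d = q n" if "\<exists>q'. perron_rep P q' x \<and> q' n = d" for d
    using that perron_rep_unique[OF _ assms] by blast
qed

lemma admissible_imp_representable:
  assumes "\<And>k. admissible_base P k q"
  obtains x where "perron_rep P q x"
proof -
  have "norm (perron_term P q n) \<le> (1 / 2) ^ n" for n
  proof -
    note b = admissible_Suc_bounds[OF assms, of n]
    have "real (perron_r P q n) / (real (q (Suc n)) - 1) \<le> 1"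
      "0 \<le> real (perron_r P q n) / (real (q (Suc n)) - 1)"
      using b by (auto simp: divide_simps)
    then have "perron_weight P q n * (real (perron_r P q n) / (real (q (Suc n)) - 1)) \<le> (1 / 2) ^ n * 1"
      using perron_weight_bounds[OF assms, of n] by (intro mult_mono) auto
    then show ?thesis
      using perron_weight_bounds[OF assms, of n] b
      by (simp add: perron_term_eq_weight abs_mult)
  qed
  then have "summable (perron_term P q)"
    by (intro summable_comparison_test'[OF summable_geometric[of "1 / 2 :: real"]]) auto
  then have "perron_rep P q (suminf (perron_term P q))"
    using assms by (simp add: perron_rep_iff summable_sums)
  then show ?thesis using that by blast
qed

section \<open>Cylinders\<close>

lemma representable_iff:
  "x \<in> {0<..<1} - perron_IS P \<longleftrightarrow> (\<exists>q. perron_rep P q x)"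
proof
  show "x \<in> {0<..<1} - perron_IS P" if "\<exists>q. perron_rep P q x"
    using that perron_rep_sum_in_unit_interval[of _ x] by (auto simp: perron_IS_def)
qed (auto simp: perron_IS_def)

lemma perron_cylinder_remainder:
  assumes "x \<in> perron_cylinder P k c"
  obtains y where "x = branch P c k y" "y \<in> {0<..<1}"
    "y < real (perron_r P c k) / (real (perron_digit P (k + 1) x) - 1)"
proof -
  obtain q where q: "perron_rep P q x"
    using assms representable_iff by (auto simp: perron_cylinder_def)
  have eq: "q i = c i" if "i \<in> {1..k}" for i
    using assms that perron_digit_eq[OF q, of i] by (auto simp: perron_cylinder_def)
  have adm: "admissible_base P (Suc k) q" using q by (simp add: perron_rep_iff)
  obtain y where y: "x = branch P q k y"
    "y \<in> {real (perron_r P q k) / real (q (Suc k))<..<real (perron_r P q k) / (real (q (Suc k)) - 1)}"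
    using perron_rep_remainder[OF q] .
  show ?thesis
  proof (rule that)
    show "x = branch P c k y" using y(1) branch_cong[of k q c P y] eq by simp
    show "y \<in> {0<..<1}" by (rule remainder_in_unit_interval[OF adm y(2)])
    show "y < real (perron_r P c k) / (real (perron_digit P (k + 1) x) - 1)"
      using y(2) perron_r_cong[of k q c P] eq perron_digit_eq[OF q, of "Suc k"] by simp
  qed
qed

lemma branch_odd: "odd k \<Longrightarrow> branch P c k y = branch P c k 0 - perron_weight P c k * y"
  by (simp add: branch_def)

text \<open>
  The remainders are positive, so the value at \<open>0\<close> is an upper bound. It is approached because
  extending the base by the digit \<open>d + 1\<close> produces a remainder of at most \<open>r\<^sub>k / d\<close>, and \<open>r\<^sub>k\<close> does not
  depend on \<open>d\<close>.
\<close>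

lemma Sup_perron_cylinder_odd:
  assumes "odd k" "admissible_base P k c"
  shows "Sup (perron_cylinder P k c) = branch P c k 0"
proof -
  let ?r = "real (perron_r P c k)" and ?A = "perron_weight P c k"
  have A: "0 < ?A" using perron_weight_bounds[OF assms(2)] by simp
  have lower: "\<exists>x\<in>perron_cylinder P k c. branch P c k 0 - ?A * (?r / real d) \<le> x"
    if d: "perron_r P c k \<le> d" for d
  proof -
    define c' where "c' = c(Suc k := Suc d)"
    have eq': "c' i = c i" if "i \<in> {1..k}" for i using that by (simp add: c'_def)
    have "admissible_base P (Suc k) c'"
      using assms(2) d admissible_base_cong[of k c' c P] perron_r_cong[of k c' c P] eq'
      by (simp add: admissible_base_Suc) (simp add: c'_def)
    then obtain q where q: "\<And>i. i \<in> {1..Suc k} \<Longrightarrow> q i = c' i" "\<And>j. admissible_base P j q"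
      using admissible_extension_exists by blast
    obtain x where x: "perron_rep P q x" using admissible_imp_representable q(2) by blast
    have dig: "perron_digit P i x = c' i" if "i \<in> {1..Suc k}" for i
      using perron_digit_eq[OF x] q(1) that by auto
    have mem: "x \<in> perron_cylinder P k c"
      unfolding perron_cylinder_def using representable_iff[of x] x dig eq' by auto
    then obtain y where y: "x = branch P c k y" "y < ?r / (real (perron_digit P (k + 1) x) - 1)"
      using perron_cylinder_remainder by metis
    have "y \<le> ?r / real d" using y(2) dig[of "Suc k"] by (simp add: c'_def)
    then have "?A * y \<le> ?A * (?r / real d)" using A by (intro mult_left_mono) auto
    then have "branch P c k 0 - ?A * (?r / real d) \<le> x"
      using y(1) branch_odd[OF assms(1), of c y] by linarith
    with mem show ?thesis by blast
  qed
  show ?thesis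
  proof (rule cSup_eq_non_empty)
    show "perron_cylinder P k c \<noteq> {}" using lower by blast
    show "x \<le> branch P c k 0" if x: "x \<in> perron_cylinder P k c" for x
    proof -
      obtain y where "x = branch P c k y" "y \<in> {0<..<1}"
        using perron_cylinder_remainder[OF x] .
      then show ?thesis using A branch_odd[OF assms(1), of c y] by simp
    qed
    fix u assume u: "\<And>x. x \<in> perron_cylinder P k c \<Longrightarrow> x \<le> u"
    have "(\<lambda>d. branch P c k 0 - ?A * (?r / real d)) \<longlonglongrightarrow> branch P c k 0 - ?A * 0"
      by (intro tendsto_intros lim_const_over_n)
    moreover have "branch P c k 0 - ?A * (?r / real d) \<le> u" if "d \<ge> perron_r P c k" for d
      using lower[OF that] u by force
    ultimately show "branch P c k 0 \<le> u"
      using LIMSEQ_le_const2[of _ "branch P c k 0" u] by auto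
  qed
qed

end

theorem proposition8:
  fixes P :: "nat \<Rightarrow> nat list \<Rightarrow> nat" and k :: nat and c :: "nat \<Rightarrow> nat"
    and x0 :: real and x :: "nat \<Rightarrow> real"
  assumes "perron_seq P"
    and "odd k"
    and "admissible_base P k c"
    and "x0 = Sup (perron_cylinder P k c)"
    and "\<And>n. n \<ge> 1 \<Longrightarrow> x n \<in> {0<..<1} - perron_IS P"
    and "\<And>n. n \<ge> 1 \<Longrightarrow> 0 < x n \<and> x n < x0"
  shows "x \<longlonglongrightarrow> x0 \<longleftrightarrow>
    (\<exists>n0\<ge>1. (\<forall>n\<ge>n0. \<forall>i\<in>{1..k}. perron_digit P i (x n) = c i) \<and>
       filterlim (\<lambda>n. perron_digit P (k + 1) (x n)) at_top sequentially)"
proof -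
  note P = assms(1)
  let ?A = "perron_weight P c k" and ?r = "real (perron_r P c k)"
  let ?d = "\<lambda>n. perron_digit P (k + 1) (x n)"
  have A: "0 < ?A" using perron_weight_bounds[OF P assms(3)] by simp
  have x0: "x0 = branch P c k 0" using Sup_perron_cylinder_odd[OF P assms(2,3)] assms(4) by simp
  have branch: "branch P c k y = x0 - ?A * y" for y
    unfolding x0 by (rule branch_odd[OF P assms(2)])
  show ?thesis
  proof
    assume lim: "x \<longlonglongrightarrow> x0"
    \<comment> \<open>The remainder of \<open>x n\<close> with respect to \<open>c\<close>, obtained by inverting the branch.\<close>
    define y where "y n = (x0 - x n) / ?A" for n
    have x_y: "x n = branch P c k (y n)" for n using A by (simp add: branch y_def)
    have y_pos: "0 < y n" if "n \<ge> 1" for n using assms(6)[OF that] A by (simp add: y_def)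
    have "y \<longlonglongrightarrow> (x0 - x0) / ?A"
      unfolding y_def using A by (intro tendsto_intros lim) auto
    then have y0: "y \<longlonglongrightarrow> 0" by simp
    \<comment> \<open>The digit \<open>d\<close> after \<open>c 1, \<dots>, c k\<close> satisfies \<open>r\<^sub>k / d < y n\<close>, and \<open>r\<^sub>k \<ge> 1\<close>.\<close>
    have small: "(\<forall>i\<in>{1..k}. perron_digit P i (x n) = c i) \<and> 1 < y n * real (?d n)"
      if n: "n \<ge> 1" "y n < 1" for n
    proof -
      obtain q where q: "perron_rep P q (x n)"
        using assms(5)[OF n(1)] representable_iff[OF P] by blast
      have eq: "q i = c i" if "i \<in> {1..k}" for i
        using digits_eq_if_branch[OF P q assms(3) _ x_y that] y_pos n by simp
      obtain w where w: "x n = branch P q k w" "real (perron_r P q k) / real (q (Suc k)) < w"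
        using perron_rep_remainder[OF P q, of k] by auto
      have "w = y n"
        using branch_inject[OF P assms(3)] w(1) x_y branch_cong[of k q c P w] eq by simp
      moreover have adm: "admissible_base P (Suc k) q" using q by (simp add: perron_rep_iff)
      note b = admissible_Suc_bounds[OF P adm]
      ultimately have "real (perron_r P q k) < y n * real (q (Suc k))"
        using w(2) by (simp add: pos_divide_less_eq)
      with b(1) have "1 < y n * real (q (Suc k))" by linarith
      then show ?thesis using perron_digit_eq[OF P q] eq by simp
    qed
    have ev1: "\<forall>\<^sub>F n in sequentially. n \<ge> 1" by (rule eventually_ge_at_top)
    have "\<forall>\<^sub>F n in sequentially. n \<ge> 1 \<and> y n < 1"
      using ev1 order_tendstoD(2)[OF y0, of 1] by (simp add: eventually_conj)
    then obtain N where "\<And>n. n \<ge> N \<Longrightarrow> n \<ge> 1 \<and> y n < 1"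
      by (auto simp: eventually_sequentially)
    then have "\<forall>n\<ge>max N 1. \<forall>i\<in>{1..k}. perron_digit P i (x n) = c i" using small by simp
    moreover have "filterlim ?d at_top sequentially"
      unfolding filterlim_at_top
    proof
      fix Z :: nat
      have "\<forall>\<^sub>F n in sequentially. y n < 1 / (real Z + 1)"
        by (rule order_tendstoD(2)[OF y0]) simp
      with ev1 show "\<forall>\<^sub>F n in sequentially. Z \<le> ?d n"
      proof eventually_elim
        case (elim n)
        have "1 / (real Z + 1) \<le> 1" by simp
        with elim small[of n] have "1 < y n * real (?d n)" by linarith
        also have "\<dots> \<le> 1 / (real Z + 1) * real (?d n)"
          using elim by (intro mult_right_mono) auto
        finally have "real Z + 1 < real (?d n)" by (simp add: field_simps)
        then show ?case by linarith
      qed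
    qed
    ultimately show "\<exists>n0\<ge>1. (\<forall>n\<ge>n0. \<forall>i\<in>{1..k}. perron_digit P i (x n) = c i) \<and>
        filterlim ?d at_top sequentially"
      by (intro exI[of _ "max N 1"]) simp
  next
    assume "\<exists>n0\<ge>1. (\<forall>n\<ge>n0. \<forall>i\<in>{1..k}. perron_digit P i (x n) = c i) \<and>
        filterlim ?d at_top sequentially"
    then obtain n0 where n0: "n0 \<ge> 1"
      and dig: "\<And>n i. n \<ge> n0 \<Longrightarrow> i \<in> {1..k} \<Longrightarrow> perron_digit P i (x n) = c i"
      and d: "filterlim ?d at_top sequentially"
      by blast
    \<comment> \<open>Conversely, the remainder is less than \<open>r\<^sub>k / (d - 1)\<close>, with the same \<open>r\<^sub>k\<close> for all \<open>n \<ge> n0\<close>.\<close>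
    have lower: "x0 - ?A * (?r / (real (?d n) - 1)) \<le> x n" if n: "n \<ge> n0" for n
    proof -
      have "x n \<in> perron_cylinder P k c"
        using assms(5)[of n] n0 n dig by (simp add: perron_cylinder_def)
      then obtain y where y: "x n = branch P c k y" "y < ?r / (real (?d n) - 1)"
        using perron_cylinder_remainder[OF P] by metis
      have "?A * y \<le> ?A * (?r / (real (?d n) - 1))"
        using y(2) A by (intro mult_left_mono) auto
      then show ?thesis using y(1) branch by simp
    qed
    have "filterlim (\<lambda>n. real (?d n)) at_top sequentially"
      by (rule filterlim_compose[OF filterlim_real_sequentially d])
    then have "filterlim (\<lambda>n. -1 + real (?d n)) at_top sequentially"
      by (rule filterlim_tendsto_add_at_top[OF tendsto_const])
    then have "(\<lambda>n. ?r / (-1 + real (?d n))) \<longlonglongrightarrow> 0"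
      by (intro tendsto_divide_0[OF tendsto_const] filterlim_at_top_imp_at_infinity)
    then have "(\<lambda>n. x0 - ?A * (?r / (-1 + real (?d n)))) \<longlonglongrightarrow> x0 - ?A * 0"
      by (intro tendsto_intros)
    then have lower_lim: "(\<lambda>n. x0 - ?A * (?r / (real (?d n) - 1))) \<longlonglongrightarrow> x0"
      by (simp add: add.commute)
    show "x \<longlonglongrightarrow> x0"
    proof (rule tendsto_sandwich[OF _ _ lower_lim tendsto_const])
      show "\<forall>\<^sub>F n in sequentially. x0 - ?A * (?r / (real (?d n) - 1)) \<le> x n"
        using lower by (auto simp: eventually_sequentially)
      show "\<forall>\<^sub>F n in sequentially. x n \<le> x0"
        using assms(6) by (force simp: eventually_sequentially)
    qed
  qed
qed

end
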